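(* Let $(Z_n)_{n\ge 0}$ be a branching process in an i.i.d. random environment $\overline{\xi}=(\xi_0,\xi_1,\dots)$ with (conditional) offspring distributions $(p_k(\xi_n))_{k\ge0}$, and let $m_n=\sum_{k\ge 0}k\,p_k(\xi_n)$, $X_i=\log m_{i-1}$ for $i\ge1$, $\mu=\mathbb{E}(X_1)$ and $\sigma^2=\mathrm{Var}(X_1)$, as defined in the context. Assume: (1) $0<\mu<+\infty$ and $\mathbb{E}|\log(1-p_0(\xi_0))|<+\infty$; (2) $0<\sigma^2<+\infty$; (3) $\mathbb{E}\left(\frac{Z_1\log^+Z_1}{m_0}\right)<+\infty$; (4) $p_0(\xi_0)=0$ $\mathbb{P}$-a.s.; (H1) $M>0$ is a constant such that for all $i\ge1$, $\frac{X_i-\mu}{M}\le 1$ $\mathbb{P}$-a.s.; (H2) there exist $p>1$ and $q>2$ such that $\mathbb{E}\left(\frac{Z_1}{m_0}\right)^p<+\infty$ and $\mathbb{E}|\log m_0|^q<+\infty$. Then there exist constants $C>0$ and $\delta\in(0,1)$ such that for any real $x\ge 3$ and any integers $1\le m\le n$, $$\mathbb{P}\left(\frac{\log Z_n-n\mu}{nM}\ge x\right)\le\frac{C\,\delta^m}{M\sqrt{n}}.$$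
   Context: Branching process in i.i.d. random environment: $\overline{\xi}=(\xi_0,\xi_1,\dots)$ is a sequence of i.i.d. random elements with common law $\nu$ (the environment). To each $\xi_n$ corresponds a probability mass function $(p_k(\xi_n))_{k\ge0}$ on $\{0,1,2,\dots\}$. The process is defined by $Z_0\equiv1$ and $Z_{n+1}=\sum_{i=1}^{Z_n}N_{n,i}$ for $n\ge0$, where, conditionally on $\overline{\xi}$, all the random variables $N_{n,i}$ ($n\ge0$, $i\ge1$) are independent and, for each $n$, the $(N_{n,i})_{i\ge1}$ are identically distributed with probability mass function $(p_k(\xi_n))_{k\ge0}$. $\mathbb{P}$ denotes the annealed (total) probability law and $\mathbb{E}$ its expectation. $m_n=\sum_{k\ge0}k\,p_k(\xi_n)$ is the conditional mean family size in generation $n$, and $X_i=\log m_{i-1}$ for $i\ge1$. $\log^+ z=\max(\log z,0)$. *)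

theory Defs
  imports "HOL-Probability.Probability"
begin

text \<open>Conditional probability of the event \<open>A\<close> given the sub-sigma-algebra \<open>F\<close>.\<close>

definition cprob :: "'w measure \<Rightarrow> 'w measure \<Rightarrow> 'w set \<Rightarrow> 'w \<Rightarrow> real" where
  "cprob P F A = real_cond_exp P F (indicator A)"

definition cond_indep_vars ::
  "'w measure \<Rightarrow> 'w measure \<Rightarrow> ('i \<Rightarrow> 'b measure) \<Rightarrow> ('i \<Rightarrow> 'w \<Rightarrow> 'b) \<Rightarrow> 'i set \<Rightarrow> bool" where
  "cond_indep_vars P F S Y I \<longleftrightarrow>
     (\<forall>i\<in>I. Y i \<in> measurable P (S i)) \<and>
     (\<forall>J A. J \<subseteq> I \<longrightarrow> J \<noteq> {} \<longrightarrow> finite J \<longrightarrow> (\<forall>j\<in>J. A j \<in> sets (S j)) \<longrightarrow>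
        (AE \<omega> in P. cprob P F (\<Inter>j\<in>J. Y j -` A j \<inter> space P) \<omega> =
                      (\<Prod>j\<in>J. cprob P F (Y j -` A j \<inter> space P) \<omega>)))"

definition env_sigma :: "'w measure \<Rightarrow> 'e measure \<Rightarrow> (nat \<Rightarrow> 'w \<Rightarrow> 'e) \<Rightarrow> 'w measure" where
  "env_sigma P \<nu> \<xi> = vimage_algebra (space P) (\<lambda>\<omega> n. \<xi> n \<omega>) (\<Pi>\<^sub>M n\<in>UNIV. \<nu>)"

text \<open>
  \<open>P\<close> is the annealed law and \<open>pmf (p e) k\<close> is $p_k(e)$.
  Only the variables \<open>N n i\<close> with \<open>i \<ge> 1\<close> are used.
\<close>

locale branching_process_iid_env = prob_space P for P :: "'w measure" +
  fixes \<nu> :: "'e measure"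
    and p :: "'e \<Rightarrow> nat pmf"
    and \<xi> :: "nat \<Rightarrow> 'w \<Rightarrow> 'e"
    and N :: "nat \<Rightarrow> nat \<Rightarrow> 'w \<Rightarrow> nat"
  assumes env_indep: "indep_vars (\<lambda>_. \<nu>) \<xi> UNIV"
    and env_law: "\<And>n. distr P \<nu> (\<xi> n) = \<nu>"
    and offspring_measurable: "\<And>k. (\<lambda>e. pmf (p e) k) \<in> borel_measurable \<nu>"
    and offspring_cond_indep:
      "cond_indep_vars P (env_sigma P \<nu> \<xi>) (\<lambda>_. count_space UNIV)
         (\<lambda>(n, i). N n i) (UNIV \<times> {1..})"
    and offspring_cond_law:
      "\<And>n i k. i \<ge> 1 \<Longrightarrow>
         AE \<omega> in P. cprob P (env_sigma P \<nu> \<xi>) {\<omega> \<in> space P. N n i \<omega> = k} \<omega> = pmf (p (\<xi> n \<omega>)) k"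

primrec gen_size :: "(nat \<Rightarrow> nat \<Rightarrow> 'w \<Rightarrow> nat) \<Rightarrow> nat \<Rightarrow> 'w \<Rightarrow> nat" where
  "gen_size N 0 \<omega> = 1"
| "gen_size N (Suc n) \<omega> = (\<Sum>i = 1..gen_size N n \<omega>. N n i \<omega>)"

text \<open>The conditional mean $m_n$; it takes values in $[0,\infty]$.\<close>

definition cond_mean :: "('e \<Rightarrow> nat pmf) \<Rightarrow> (nat \<Rightarrow> 'w \<Rightarrow> 'e) \<Rightarrow> nat \<Rightarrow> 'w \<Rightarrow> ennreal" where
  "cond_mean p \<xi> n \<omega> = (\<Sum>k. of_nat k * ennreal (pmf (p (\<xi> n \<omega>)) k))"

text \<open>
  Real-valued versions of $m_n$ and of $X_i = \log m_{i-1}$ for \<open>i \<ge> 1\<close>. They are the intended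
  values only where $m_n$ is positive and finite, because \<open>enn2real \<infinity> = 0\<close> and \<open>ln 0 = 0\<close>.
\<close>

definition real_mean :: "('e \<Rightarrow> nat pmf) \<Rightarrow> (nat \<Rightarrow> 'w \<Rightarrow> 'e) \<Rightarrow> nat \<Rightarrow> 'w \<Rightarrow> real" where
  "real_mean p \<xi> n \<omega> = enn2real (cond_mean p \<xi> n \<omega>)"

definition log_mean :: "('e \<Rightarrow> nat pmf) \<Rightarrow> (nat \<Rightarrow> 'w \<Rightarrow> 'e) \<Rightarrow> nat \<Rightarrow> 'w \<Rightarrow> real" where
  "log_mean p \<xi> i \<omega> = ln (real_mean p \<xi> (i - 1) \<omega>)"

text \<open>
  $\mathbb{E}|\log Y| < \infty$ for a $[0,\infty]$-valued \<open>Y\<close>, where $\log 0 = -\infty$ and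
  $\log \infty = \infty$: finiteness of the expectation forces $0 < Y < \infty$ almost surely,
  which integrability of the totalised real logarithm alone would not.
\<close>

definition log_integrable :: "'w measure \<Rightarrow> ('w \<Rightarrow> ennreal) \<Rightarrow> bool" where
  "log_integrable P Y \<longleftrightarrow>
     (AE \<omega> in P. 0 < Y \<omega> \<and> Y \<omega> < \<infinity>) \<and> integrable P (\<lambda>\<omega>. ln (enn2real (Y \<omega>)))"

definition log_plus :: "real \<Rightarrow> real" where
  "log_plus z = max (ln z) 0"

end

theory Submission
  imports Defs
begin

text \<open>
  Since $X_i \le \mu + M$ almost surely, the annealed mean of $Z_n$ is at most $e^{n(\mu+M)}$.
  The event in question is contained in $\{Z_n \ge e^{n\mu + 3nM}\}$, so by Markov's inequality
  it has probability at most
  $e^{-2nM} \le e^{-nM} / (nM) \le e^{-mM} / (M\sqrt n)$; take $C = 1$ and $\delta = e^{-M}$.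
\<close>

text \<open>Registered for the measurability prover because the decompositions below run over the
  values of \<open>gen_size N n\<close> and \<open>N n i\<close>, written as indicators of
  singletons.\<close>

lemma borel_measurable_indicator_singleton [measurable]:
  assumes "f \<in> measurable M (count_space UNIV)"
  shows "(\<lambda>x. indicator {z} (f x) :: ennreal) \<in> borel_measurable M"
  by (rule measurable_compose[OF assms]) simp

context branching_process_iid_env
begin

section \<open>Measurability of the environment and of the generation sizes\<close>

lemma env_measurable: "\<xi> n \<in> measurable P \<nu>"
  using env_indep by (auto simp: indep_vars_def)

lemma env_space: "\<omega> \<in> space P \<Longrightarrow> \<xi> n \<omega> \<in> space \<nu>"
  using env_measurable by (rule measurable_space)

lemma env_measurable_env_sigma: "\<xi> n \<in> measurable (env_sigma P \<nu> \<xi>) \<nu>"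
proof -
  have "(\<lambda>\<omega> n. \<xi> n \<omega>) \<in> measurable (env_sigma P \<nu> \<xi>) (\<Pi>\<^sub>M n\<in>UNIV. \<nu>)"
    unfolding env_sigma_def
    by (rule measurable_vimage_algebra1) (auto simp: space_PiM env_space)
  then show ?thesis
    using measurable_compose[OF _ measurable_component_singleton[of n UNIV "\<lambda>_. \<nu>"]] by fastforce
qed

lemma subalgebra_env_sigma: "subalgebra P (env_sigma P \<nu> \<xi>)"
proof -
  have meas: "(\<lambda>\<omega> n. \<xi> n \<omega>) \<in> measurable P (\<Pi>\<^sub>M n\<in>UNIV. \<nu>)"
    by (rule measurable_PiM_single') (auto simp: env_measurable env_space)
  then have "sets (env_sigma P \<nu> \<xi>) =
      {(\<lambda>\<omega> n. \<xi> n \<omega>) -` A \<inter> space P |A. A \<in> sets (\<Pi>\<^sub>M n\<in>UNIV. \<nu>)}"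
    unfolding env_sigma_def by (intro sets_vimage_algebra2) (auto dest: measurable_space)
  also have "\<dots> \<subseteq> sets P" using measurable_sets[OF meas] by auto
  finally show ?thesis by (simp add: subalgebra_def env_sigma_def)
qed

lemma offspring_random_variable: "i \<ge> 1 \<Longrightarrow> N n i \<in> measurable P (count_space UNIV)"
  using offspring_cond_indep unfolding cond_indep_vars_def by force

lemma gen_size_measurable [measurable]: "gen_size N n \<in> measurable P (count_space UNIV)"
proof (induction n)
  case 0
  have "gen_size N 0 = (\<lambda>_. 1)" by auto
  then show ?case by simp
next
  case (Suc n)
  have *: "(\<lambda>\<omega>. \<Sum>i=1..z. N n i \<omega>) \<in> measurable P (count_space UNIV)" for z
    by (intro measurable_sum_nat offspring_random_variable) auto
  \<comment> \<open>The number of summands is random but takes countably many values, so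
    measurability for each fixed number \<open>z\<close> of summands is enough.\<close>
  have "(\<lambda>\<omega>. (\<lambda>z \<omega>. \<Sum>i=1..z. N n i \<omega>) (gen_size N n \<omega>) \<omega>)
          \<in> measurable P (count_space UNIV)"
    by (rule measurable_compose_countable[OF * Suc.IH])
  moreover have "gen_size N (Suc n) = (\<lambda>\<omega>. \<Sum>i=1..gen_size N n \<omega>. N n i \<omega>)" by (rule ext) simp
  ultimately show ?case by simp
qed

lemma pmf_offspring_measurable:
  "(\<lambda>\<omega>. pmf (p (\<xi> n \<omega>)) k) \<in> borel_measurable (env_sigma P \<nu> \<xi>)"
  by (rule measurable_compose[OF env_measurable_env_sigma offspring_measurable])

lemma pmf_offspring_measurable_P [measurable]:
  "(\<lambda>\<omega>. pmf (p (\<xi> n \<omega>)) k) \<in> borel_measurable P"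
  by (rule measurable_compose[OF env_measurable offspring_measurable])

section \<open>Cylinder events of offspring numbers and their conditional probabilities\<close>

definition cyl :: "(nat \<times> nat) set \<Rightarrow> (nat \<times> nat \<Rightarrow> nat) \<Rightarrow> 'w set" where
  "cyl J a = {\<omega> \<in> space P. \<forall>(k, i)\<in>J. N k i \<omega> = a (k, i)}"

text \<open>For finite \<open>J\<close> with second coordinates at least 1, this is a version of the
  conditional probability of \<open>cyl J a\<close> given the environment.\<close>

definition env_weight :: "(nat \<times> nat) set \<Rightarrow> (nat \<times> nat \<Rightarrow> nat) \<Rightarrow> 'w \<Rightarrow> real" where
  "env_weight J a \<omega> = (\<Prod>j\<in>J. pmf (p (\<xi> (fst j) \<omega>)) (a j))"

lemma cyl_measurable [measurable]:
  assumes "finite J" "J \<subseteq> UNIV \<times> {1..}"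
  shows "cyl J a \<in> sets P"
proof -
  have "cyl J a = {\<omega> \<in> space P. \<forall>j\<in>J. N (fst j) (snd j) \<omega> = a j}"
    by (auto simp: cyl_def)
  also have "\<dots> \<in> sets P"
  proof (rule sets.sets_Collect_finite_All[OF _ assms(1)])
    fix j assume "j \<in> J"
    then have [measurable]: "N (fst j) (snd j) \<in> measurable P (count_space UNIV)"
      using assms(2) by (intro offspring_random_variable) auto
    show "{\<omega> \<in> space P. N (fst j) (snd j) \<omega> = a j} \<in> sets P" by measurable
  qed
  finally show ?thesis .
qed

lemma env_weight_measurable: "env_weight J a \<in> borel_measurable (env_sigma P \<nu> \<xi>)"
  unfolding env_weight_def by (intro borel_measurable_prod pmf_offspring_measurable)

lemma env_weight_bounds: "0 \<le> env_weight J a \<omega>" "env_weight J a \<omega> \<le> 1"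
  unfolding env_weight_def by (auto intro!: prod_nonneg prod_le_1 pmf_le_1)

text \<open>Conditional independence factors the probability over \<open>J\<close>, and the
  conditional offspring law identifies each factor. The set \<open>J\<close> is nonempty because the
  independence assumption speaks of nonempty index sets, and an intersection over the empty set
  would be \<open>UNIV\<close> instead of \<open>space P\<close>.\<close>

lemma cprob_cyl:
  assumes "finite J" "J \<subseteq> UNIV \<times> {1..}" "J \<noteq> {}"
  shows "AE \<omega> in P. cprob P (env_sigma P \<nu> \<xi>) (cyl J a) \<omega> = env_weight J a \<omega>"
proof -
  let ?F = "env_sigma P \<nu> \<xi>"
  let ?Y = "\<lambda>j. case j of (n, i) \<Rightarrow> N n i"
  have prod: "AE \<omega> in P. cprob P ?F (\<Inter>j\<in>J. ?Y j -` {a j} \<inter> space P) \<omega> =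
          (\<Prod>j\<in>J. cprob P ?F (?Y j -` {a j} \<inter> space P) \<omega>)"
    using offspring_cond_indep assms unfolding cond_indep_vars_def by auto
  have cyl: "(\<Inter>j\<in>J. ?Y j -` {a j} \<inter> space P) = cyl J a"
    using assms(3) by (auto simp: cyl_def)
  have "AE \<omega> in P. \<forall>j\<in>J. cprob P ?F (?Y j -` {a j} \<inter> space P) \<omega> =
      pmf (p (\<xi> (fst j) \<omega>)) (a j)"
  proof (rule AE_finite_allI[OF assms(1)])
    fix j assume "j \<in> J"
    then obtain n i where j: "j = (n, i)" "i \<ge> 1" using assms(2) by force
    have "?Y j -` {a j} \<inter> space P = {\<omega> \<in> space P. N n i \<omega> = a j}" using j by auto
    with offspring_cond_law[OF j(2), of n "a j"]
    show "AE \<omega> in P. cprob P ?F (?Y j -` {a j} \<inter> space P) \<omega> = pmf (p (\<xi> (fst j) \<omega>)) (a j)"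
      using j by simp
  qed
  with prod show ?thesis
    unfolding cyl by eventually_elim (simp add: env_weight_def)
qed

text \<open>This is the defining property of conditional expectation, tested against an
  environment-measurable \<open>h\<close>; the bounds on \<open>h\<close> make everything
  integrable. For empty \<open>J\<close> the cylinder is \<open>space P\<close> and the weight is
  the empty product 1.\<close>

lemma nn_integral_cyl:
  assumes J: "finite J" "J \<subseteq> UNIV \<times> {1..}"
    and h: "h \<in> borel_measurable (env_sigma P \<nu> \<xi>)" "\<And>\<omega>. 0 \<le> h \<omega>" "\<And>\<omega>. h \<omega> \<le> (1::real)"
  shows "(\<integral>\<^sup>+\<omega>. ennreal (h \<omega>) * indicator (cyl J a) \<omega> \<partial>P) =
         (\<integral>\<^sup>+\<omega>. ennreal (h \<omega> * env_weight J a \<omega>) \<partial>P)"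
proof (cases "J = {}")
  case True
  then show ?thesis by (auto simp: cyl_def env_weight_def intro!: nn_integral_cong)
next
  case False
  let ?F = "env_sigma P \<nu> \<xi>"
  interpret finite_measure_subalgebra P ?F
    by unfold_locales (rule subalgebra_env_sigma)
  have hP [measurable]: "h \<in> borel_measurable P"
    by (rule measurable_from_subalg[OF subalgebra_env_sigma h(1)])
  have wP [measurable]: "env_weight J a \<in> borel_measurable P"
    by (rule measurable_from_subalg[OF subalgebra_env_sigma env_weight_measurable])
  have cyl [measurable]: "cyl J a \<in> sets P" using J by simp
  have int: "integrable P (\<lambda>\<omega>. h \<omega> * indicator (cyl J a) \<omega>)"
    by (rule integrable_const_bound[where B=1]) (use h in \<open>auto simp: indicator_def\<close>)
  have int2: "integrable P (\<lambda>\<omega>. h \<omega> * env_weight J a \<omega>)"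
    by (rule integrable_const_bound[where B=1])
      (use h env_weight_bounds in \<open>auto simp: abs_mult intro!: mult_le_one\<close>)
  have "(\<integral>\<omega>. h \<omega> * indicator (cyl J a) \<omega> \<partial>P) =
        (\<integral>\<omega>. h \<omega> * real_cond_exp P ?F (indicator (cyl J a)) \<omega> \<partial>P)"
    by (rule real_cond_exp_intg(2)[OF int h(1), symmetric]) simp
  also have "\<dots> = (\<integral>\<omega>. h \<omega> * env_weight J a \<omega> \<partial>P)"
    by (rule integral_cong_AE) (use cprob_cyl[OF J False, of a] in \<open>auto simp: cprob_def\<close>)
  finally have eq: "(\<integral>\<omega>. h \<omega> * indicator (cyl J a) \<omega> \<partial>P) = (\<integral>\<omega>. h \<omega> * env_weight J a \<omega> \<partial>P)" .
  have "(\<integral>\<^sup>+\<omega>. ennreal (h \<omega>) * indicator (cyl J a) \<omega> \<partial>P) =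
        (\<integral>\<^sup>+\<omega>. ennreal (h \<omega> * indicator (cyl J a) \<omega>) \<partial>P)"
    by (intro nn_integral_cong) (auto simp: indicator_def)
  also have "\<dots> = (\<integral>\<^sup>+\<omega>. ennreal (h \<omega> * env_weight J a \<omega>) \<partial>P)"
    using eq h env_weight_bounds
    by (simp add: nn_integral_eq_integral[OF int] nn_integral_eq_integral[OF int2])
  finally show ?thesis .
qed

section \<open>Conditional independence of a generation size and later offspring numbers\<close>

definition brood :: "nat \<Rightarrow> nat list \<Rightarrow> 'w set" where
  "brood n l = {\<omega> \<in> space P. gen_size N n \<omega> = length l \<and> (\<forall>i<length l. N n (Suc i) \<omega> = l ! i)}"

text \<open>Each outcome lies in \<open>brood n l\<close> for exactly one list \<open>l\<close>, the
  list of family sizes in generation \<open>n\<close>, and its sum is the next generation size.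
  Hence the integral over all lists has a single possibly nonzero term. Lists of naturals are
  countable, which later permits exchanging this integral with the one over
  \<open>P\<close>.\<close>

lemma indicator_gen_size_Suc:
  assumes "\<omega> \<in> space P"
  shows "indicator {z} (gen_size N (Suc n) \<omega>) =
         (\<integral>\<^sup>+l. indicator {l. sum_list l = z} l * indicator (brood n l) \<omega> \<partial>count_space UNIV)"
proof -
  define l0 where "l0 = map (\<lambda>i. N n (Suc i) \<omega>) [0..<gen_size N n \<omega>]"
  have mem: "\<omega> \<in> brood n l \<longleftrightarrow> l = l0" for l
    unfolding brood_def l0_def list_eq_iff_nth_eq using assms by (auto simp del: upt_Suc)
  have s: "sum_list l0 = gen_size N (Suc n) \<omega>"
    by (simp add: l0_def sum.atLeast1_atMost_eq interv_sum_list_conv_sum_set_nat lessThan_atLeast0)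
  have "(\<integral>\<^sup>+l. indicator {l. sum_list l = z} l * indicator (brood n l) \<omega> \<partial>count_space UNIV) =
        (\<integral>\<^sup>+l. indicator {l. sum_list l = z} l0 * indicator {l0} l \<partial>count_space UNIV)"
    by (intro nn_integral_cong) (auto simp: indicator_def mem)
  also have "\<dots> = indicator {z} (gen_size N (Suc n) \<omega>)"
    by (subst nn_integral_cmult_indicator) (auto simp: s indicator_def simp del: gen_size.simps)
  finally show ?thesis by simp
qed

text \<open>
  Given the environment, the current generation size is independent of the present and future
  offspring numbers. The event \<open>Z\<^sub>n\<^sub>+\<^sub>1 = z\<close> is split into the countably many
  events \<open>brood n l\<close>, each a cylinder intersected with \<open>Z\<^sub>n = length l\<close>;
  letting the weight \<open>h\<close> vary allows the induction hypothesis to be used in both directions.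
\<close>

lemma nn_integral_gen_size_cyl:
  assumes "finite J" "J \<subseteq> {n..} \<times> {1..}"
    and "h \<in> borel_measurable (env_sigma P \<nu> \<xi>)" "\<And>\<omega>. 0 \<le> h \<omega>" "\<And>\<omega>. h \<omega> \<le> (1::real)"
  shows "(\<integral>\<^sup>+\<omega>. ennreal (h \<omega>) * indicator {z} (gen_size N n \<omega>) * indicator (cyl J a) \<omega> \<partial>P) =
         (\<integral>\<^sup>+\<omega>. ennreal (h \<omega> * env_weight J a \<omega>) * indicator {z} (gen_size N n \<omega>) \<partial>P)"
  using assms
proof (induction n arbitrary: J a h z)
  case 0
  then have J: "finite J" "J \<subseteq> UNIV \<times> {1..}" by auto
  \<comment> \<open>The initial size is the constant 1, so its indicator is identically 1 or
    identically 0.\<close>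
  have "(\<integral>\<^sup>+\<omega>. ennreal (h \<omega>) * indicator {z} (gen_size N 0 \<omega>) * indicator (cyl J a) \<omega> \<partial>P) =
        (if z = 1 then \<integral>\<^sup>+\<omega>. ennreal (h \<omega>) * indicator (cyl J a) \<omega> \<partial>P else 0)"
    by (auto intro!: nn_integral_cong)
  also have "\<dots> = (if z = 1 then \<integral>\<^sup>+\<omega>. ennreal (h \<omega> * env_weight J a \<omega>) \<partial>P else 0)"
    using nn_integral_cyl[OF J 0(3-5)] by simp
  also have "\<dots> = (\<integral>\<^sup>+\<omega>. ennreal (h \<omega> * env_weight J a \<omega>) * indicator {z} (gen_size N 0 \<omega>) \<partial>P)"
    by (auto intro!: nn_integral_cong)
  finally show ?case .
next
  case (Suc n)
  have J: "finite J" "J \<subseteq> {n..} \<times> {1..}" "J \<subseteq> UNIV \<times> {1..}" using Suc.prems by auto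
  have [measurable]: "cyl J a \<in> sets P" using J by simp
  have hP [measurable]: "h \<in> borel_measurable P"
    by (rule measurable_from_subalg[OF subalgebra_env_sigma Suc.prems(3)])
  have wP [measurable]: "env_weight J' a' \<in> borel_measurable P" for J' a'
    by (rule measurable_from_subalg[OF subalgebra_env_sigma env_weight_measurable])
  \<comment> \<open>\<open>K l\<close> indexes the family sizes recorded by \<open>l\<close>. The
    assignment \<open>b l\<close> reads generation \<open>n\<close> from \<open>l\<close>, shifting
    from individuals counted from 1 to list positions counted from 0, and agrees with
    \<open>a\<close> elsewhere. As \<open>J\<close> lies in generations after \<open>n\<close>, the
    two prescriptions never clash.\<close>
  define K where "K l = (\<lambda>i. (n, Suc i)) ` {..<length l}" for l :: "nat list"
  define b where "b l = (\<lambda>(k, i). if k = n then l ! (i - 1) else a (k, i))" for l :: "nat list"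
  have K: "finite (K l)" "K l \<subseteq> {n..} \<times> {1..}" "K l \<subseteq> UNIV \<times> {1..}" "K l \<inter> J = {}" for l
    using Suc.prems(2) by (auto simp: K_def)
  have [measurable]: "cyl (K l) (b l) \<in> sets P" for l using K by simp
  have brood: "brood n l = {\<omega> \<in> space P. gen_size N n \<omega> = length l} \<inter> cyl (K l) (b l)" for l
    by (auto simp: brood_def cyl_def K_def b_def)
  have [measurable]: "brood n l \<in> sets P" for l unfolding brood by measurable
  have ab: "cyl J (b l) = cyl J a" "env_weight J (b l) = env_weight J a" for l
    using Suc.prems(2) by (auto simp: cyl_def env_weight_def b_def fun_eq_iff intro!: prod.cong)
  have U: "finite (K l \<union> J)" "K l \<union> J \<subseteq> {n..} \<times> {1..}" for l
    using J K(1,2) by auto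
  have wU: "env_weight (K l \<union> J) (b l) \<omega> = env_weight J a \<omega> * env_weight (K l) (b l) \<omega>" for l \<omega>
    unfolding ab(2)[of l, symmetric] unfolding env_weight_def
    using J K by (subst prod.union_disjoint) auto
  have cU: "cyl (K l \<union> J) (b l) = cyl (K l) (b l) \<inter> cyl J a" for l
    unfolding ab(1)[of l, symmetric] by (auto simp: cyl_def)
  \<comment> \<open>The product is again environment-measurable with values in $[0,1]$, so it is an
    admissible weight for the induction hypothesis.\<close>
  let ?h = "\<lambda>\<omega>. h \<omega> * env_weight J a \<omega>"
  have h': "?h \<in> borel_measurable (env_sigma P \<nu> \<xi>)" "\<And>\<omega>. 0 \<le> ?h \<omega>" "\<And>\<omega>. ?h \<omega> \<le> 1"
    using Suc.prems(3-5) env_weight_bounds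
    by (auto intro!: borel_measurable_times env_weight_measurable mult_le_one)
  \<comment> \<open>The induction hypothesis for \<open>K l \<union> J\<close> replaces the whole
    cylinder by its weight, which factors over the disjoint sets \<open>K l\<close> and
    \<open>J\<close>. Read backwards for \<open>K l\<close> with weight \<open>?h\<close>, it
    restores the cylinder of generation \<open>n\<close>, so only the part over \<open>J\<close>
    stays replaced.\<close>
  have step: "(\<integral>\<^sup>+\<omega>. ennreal (h \<omega>) * indicator (cyl J a) \<omega> * indicator (brood n l) \<omega> \<partial>P) =
              (\<integral>\<^sup>+\<omega>. ennreal (?h \<omega>) * indicator (brood n l) \<omega> \<partial>P)" for l
  proof -
    let ?z = "length l"
    have "(\<integral>\<^sup>+\<omega>. ennreal (h \<omega>) * indicator (cyl J a) \<omega> * indicator (brood n l) \<omega> \<partial>P) =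
      (\<integral>\<^sup>+\<omega>. ennreal (h \<omega>) * indicator {?z} (gen_size N n \<omega>) * indicator (cyl (K l \<union> J) (b l)) \<omega> \<partial>P)"
      by (intro nn_integral_cong) (auto simp: brood cU indicator_def)
    also have "\<dots> =
      (\<integral>\<^sup>+\<omega>. ennreal (h \<omega> * env_weight (K l \<union> J) (b l) \<omega>) * indicator {?z} (gen_size N n \<omega>) \<partial>P)"
      by (rule Suc.IH[OF U Suc.prems(3-5)])
    also have "\<dots> =
      (\<integral>\<^sup>+\<omega>. ennreal (?h \<omega> * env_weight (K l) (b l) \<omega>) * indicator {?z} (gen_size N n \<omega>) \<partial>P)"
      by (simp add: wU mult.assoc)
    also have "\<dots> =
      (\<integral>\<^sup>+\<omega>. ennreal (?h \<omega>) * indicator {?z} (gen_size N n \<omega>) * indicator (cyl (K l) (b l)) \<omega> \<partial>P)"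
      by (rule Suc.IH[OF K(1,2) h', symmetric])
    also have "\<dots> = (\<integral>\<^sup>+\<omega>. ennreal (?h \<omega>) * indicator (brood n l) \<omega> \<partial>P)"
      by (intro nn_integral_cong) (auto simp: brood indicator_def)
    finally show ?thesis .
  qed
  \<comment> \<open>Tonelli's theorem for \<open>P\<close> and the counting measure on lists.
    Applied to both sides of the claim, it reduces the claim to \<open>step\<close> for each
    list.\<close>
  have split: "(\<integral>\<^sup>+\<omega>. g \<omega> * indicator {z} (gen_size N (Suc n) \<omega>) \<partial>P) =
      (\<integral>\<^sup>+l. indicator {l. sum_list l = z} l * (\<integral>\<^sup>+\<omega>. g \<omega> * indicator (brood n l) \<omega> \<partial>P)
         \<partial>count_space UNIV)"
    if [measurable]: "g \<in> borel_measurable P" for g :: "'w \<Rightarrow> ennreal"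
  proof -
    have "(\<integral>\<^sup>+\<omega>. g \<omega> * indicator {z} (gen_size N (Suc n) \<omega>) \<partial>P) =
      (\<integral>\<^sup>+\<omega>. (\<integral>\<^sup>+l. indicator {l. sum_list l = z} l * (g \<omega> * indicator (brood n l) \<omega>)
         \<partial>count_space UNIV) \<partial>P)"
      by (intro nn_integral_cong)
        (simp add: indicator_gen_size_Suc nn_integral_cmult[symmetric] mult_ac del: gen_size.simps)
    also have "\<dots> = (\<integral>\<^sup>+l. (\<integral>\<^sup>+\<omega>. indicator {l. sum_list l = z} l * (g \<omega> * indicator (brood n l) \<omega>) \<partial>P)
         \<partial>count_space UNIV)"
      by (subst nn_integral_count_space_nn_integral) auto
    also have "\<dots> = (\<integral>\<^sup>+l. indicator {l. sum_list l = z} l * (\<integral>\<^sup>+\<omega>. g \<omega> * indicator (brood n l) \<omega> \<partial>P)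
         \<partial>count_space UNIV)"
      by (simp add: nn_integral_cmult)
    finally show ?thesis .
  qed
  have "(\<integral>\<^sup>+\<omega>. ennreal (h \<omega>) * indicator {z} (gen_size N (Suc n) \<omega>) * indicator (cyl J a) \<omega> \<partial>P) =
        (\<integral>\<^sup>+\<omega>. ennreal (h \<omega>) * indicator (cyl J a) \<omega> * indicator {z} (gen_size N (Suc n) \<omega>) \<partial>P)"
    by (simp add: mult_ac del: gen_size.simps)
  also have "\<dots> = (\<integral>\<^sup>+\<omega>. ennreal (?h \<omega>) * indicator {z} (gen_size N (Suc n) \<omega>) \<partial>P)"
    by (subst (1 2) split) (simp_all add: step)
  finally show ?case .
qed

section \<open>The annealed mean of the generation sizes\<close>

text \<open>For each value \<open>k\<close> of \<open>N n i\<close>, the one-point cylinder at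
  \<open>(n, i)\<close> with weight 1 replaces the indicator of \<open>N n i = k\<close> by the
  conditional probability of \<open>k\<close>. Multiplying by \<open>k\<close> and summing yields
  the conditional mean. Nonnegative integrals keep this valid even where the mean is
  infinite.\<close>

lemma nn_integral_offspring:
  assumes "i \<ge> 1"
  shows "(\<integral>\<^sup>+\<omega>. indicator {z} (gen_size N n \<omega>) * of_nat (N n i \<omega>) \<partial>P) =
         (\<integral>\<^sup>+\<omega>. indicator {z} (gen_size N n \<omega>) * cond_mean p \<xi> n \<omega> \<partial>P)"
proof -
  have [measurable]: "N n i \<in> measurable P (count_space UNIV)"
    by (rule offspring_random_variable[OF assms])
  have J: "finite {(n, i)}" "{(n, i)} \<subseteq> {n..} \<times> {1..}" using assms by auto
  have k: "(\<integral>\<^sup>+\<omega>. indicator {z} (gen_size N n \<omega>) * indicator {k} (N n i \<omega>) \<partial>P) =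
           (\<integral>\<^sup>+\<omega>. indicator {z} (gen_size N n \<omega>) * ennreal (pmf (p (\<xi> n \<omega>)) k) \<partial>P)" for k
  proof -
    have "(\<integral>\<^sup>+\<omega>. indicator {z} (gen_size N n \<omega>) * indicator {k} (N n i \<omega>) \<partial>P) =
      (\<integral>\<^sup>+\<omega>. ennreal 1 * indicator {z} (gen_size N n \<omega>) * indicator (cyl {(n, i)} (\<lambda>_. k)) \<omega> \<partial>P)"
      by (intro nn_integral_cong) (auto simp: cyl_def indicator_def)
    also have "\<dots> = (\<integral>\<^sup>+\<omega>. indicator {z} (gen_size N n \<omega>) * ennreal (pmf (p (\<xi> n \<omega>)) k) \<partial>P)"
      by (subst nn_integral_gen_size_cyl[OF J]) (auto simp: env_weight_def mult_ac)
    finally show ?thesis .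
  qed
  have of_nat: "(of_nat y :: ennreal) = (\<Sum>k. of_nat k * indicator {k} y)" for y :: nat
  proof -
    have "(\<Sum>k. of_nat k * indicator {k} y :: ennreal) = (\<Sum>k\<in>{y}. of_nat k * indicator {k} y)"
      by (rule suminf_finite) auto
    then show ?thesis by simp
  qed
  \<comment> \<open>Used forwards to isolate a single value \<open>k\<close>, then backwards to
    reassemble the series as the conditional mean.\<close>
  have swap: "(\<integral>\<^sup>+\<omega>. (\<Sum>k. of_nat k * g k \<omega>) \<partial>P) = (\<Sum>k. of_nat k * (\<integral>\<^sup>+\<omega>. g k \<omega> \<partial>P))"
    if [measurable]: "\<And>k. g k \<in> borel_measurable P" for g :: "nat \<Rightarrow> 'w \<Rightarrow> ennreal"
  proof -
    have "(\<integral>\<^sup>+\<omega>. (\<Sum>k. of_nat k * g k \<omega>) \<partial>P) = (\<Sum>k. \<integral>\<^sup>+\<omega>. of_nat k * g k \<omega> \<partial>P)"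
      by (rule nn_integral_suminf) measurable
    then show ?thesis by (simp add: nn_integral_cmult)
  qed
  have "(\<integral>\<^sup>+\<omega>. indicator {z} (gen_size N n \<omega>) * of_nat (N n i \<omega>) \<partial>P) =
        (\<integral>\<^sup>+\<omega>. (\<Sum>k. of_nat k * (indicator {z} (gen_size N n \<omega>) * indicator {k} (N n i \<omega>))) \<partial>P)"
    by (subst of_nat) (simp add: ennreal_suminf_cmult[symmetric] mult_ac del: ennreal_suminf_cmult)
  also have "\<dots> = (\<Sum>k. of_nat k * (\<integral>\<^sup>+\<omega>. indicator {z} (gen_size N n \<omega>) * indicator {k} (N n i \<omega>) \<partial>P))"
    by (rule swap) measurable
  also have "\<dots> = (\<integral>\<^sup>+\<omega>. (\<Sum>k. of_nat k * (indicator {z} (gen_size N n \<omega>) * ennreal (pmf (p (\<xi> n \<omega>)) k))) \<partial>P)"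
    unfolding k by (rule swap[symmetric]) measurable
  also have "\<dots> = (\<integral>\<^sup>+\<omega>. indicator {z} (gen_size N n \<omega>) * cond_mean p \<xi> n \<omega> \<partial>P)"
    unfolding cond_mean_def
    by (simp add: ennreal_suminf_cmult[symmetric] mult_ac del: ennreal_suminf_cmult)
  finally show ?thesis .
qed

text \<open>On the event that generation \<open>n\<close> has size \<open>z\<close>, each of the
  \<open>z\<close> individuals contributes a mean of at most \<open>c\<close> times the probability
  of that event, because the bound on the conditional mean is a constant. Summing over
  \<open>z\<close> multiplies the mean generation size by at most \<open>c\<close> per
  generation.\<close>

lemma nn_integral_gen_size_le:
  assumes "\<And>n. AE \<omega> in P. cond_mean p \<xi> n \<omega> \<le> c"
  shows "(\<integral>\<^sup>+\<omega>. of_nat (gen_size N n \<omega>) \<partial>P) \<le> c ^ n"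
proof (induction n)
  case 0
  show ?case by (simp add: emeasure_space_1)
next
  case (Suc n)
  \<comment> \<open>Fixing the size to \<open>z\<close> makes the upper limit of the offspring sum
    deterministic, so that it can be exchanged with the integral.\<close>
  have split: "f (gen_size N n \<omega>) = (\<Sum>z. indicator {z} (gen_size N n \<omega>) * f z)"
    for f :: "nat \<Rightarrow> ennreal" and \<omega>
  proof -
    have "(\<Sum>z. indicator {z} (gen_size N n \<omega>) * f z) =
          (\<Sum>z\<in>{gen_size N n \<omega>}. indicator {z} (gen_size N n \<omega>) * f z)"
      by (rule suminf_finite) auto
    then show ?thesis by simp
  qed
  have meas: "(\<lambda>\<omega>. indicator {z} (gen_size N n \<omega>) * (of_nat (N n i \<omega>) :: ennreal))
      \<in> borel_measurable P"
    if "i \<in> {1..z}" for i z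
  proof -
    have [measurable]: "N n i \<in> measurable P (count_space UNIV)"
      using that by (intro offspring_random_variable) auto
    show ?thesis by measurable
  qed
  have "(\<integral>\<^sup>+\<omega>. of_nat (gen_size N (Suc n) \<omega>) \<partial>P) =
        (\<integral>\<^sup>+\<omega>. (\<Sum>z. \<Sum>i=1..z. indicator {z} (gen_size N n \<omega>) * of_nat (N n i \<omega>)) \<partial>P)"
  proof (rule nn_integral_cong)
    fix \<omega>
    show "of_nat (gen_size N (Suc n) \<omega>) =
        (\<Sum>z. \<Sum>i=1..z. indicator {z} (gen_size N n \<omega>) * (of_nat (N n i \<omega>) :: ennreal))"
      using split[of "\<lambda>z. \<Sum>i=1..z. of_nat (N n i \<omega>)" \<omega>]
      by (simp only: gen_size.simps of_nat_sum sum_distrib_left)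
  qed
  also have "\<dots> = (\<Sum>z. \<Sum>i=1..z. \<integral>\<^sup>+\<omega>. indicator {z} (gen_size N n \<omega>) * of_nat (N n i \<omega>) \<partial>P)"
  proof (subst nn_integral_suminf)
    show "(\<lambda>\<omega>. \<Sum>i=1..z. indicator {z} (gen_size N n \<omega>) * (of_nat (N n i \<omega>) :: ennreal))
        \<in> borel_measurable P" for z
      by (rule borel_measurable_sum[OF meas])
  qed (simp only: nn_integral_sum[OF meas])
  also have "\<dots> \<le> (\<Sum>z. c * \<integral>\<^sup>+\<omega>. indicator {z} (gen_size N n \<omega>) * of_nat z \<partial>P)"
  proof (intro suminf_le summableI)
    fix z
    have "(\<Sum>i=1..z. \<integral>\<^sup>+\<omega>. indicator {z} (gen_size N n \<omega>) * of_nat (N n i \<omega>) \<partial>P) =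
          (\<Sum>i=1..z. \<integral>\<^sup>+\<omega>. indicator {z} (gen_size N n \<omega>) * cond_mean p \<xi> n \<omega> \<partial>P)"
      by (intro sum.cong refl nn_integral_offspring) auto
    also have "\<dots> \<le> (\<Sum>i=1..z. \<integral>\<^sup>+\<omega>. c * indicator {z} (gen_size N n \<omega>) \<partial>P)"
    proof (intro sum_mono nn_integral_mono_AE)
      show "AE \<omega> in P. indicator {z} (gen_size N n \<omega>) * cond_mean p \<xi> n \<omega>
              \<le> c * indicator {z} (gen_size N n \<omega>)"
        using assms[of n] by eventually_elim (auto simp: indicator_def)
    qed
    also have "\<dots> = c * \<integral>\<^sup>+\<omega>. indicator {z} (gen_size N n \<omega>) * of_nat z \<partial>P"
      by (simp add: nn_integral_cmult nn_integral_multc mult_ac)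
    finally show "(\<Sum>i=1..z. \<integral>\<^sup>+\<omega>. indicator {z} (gen_size N n \<omega>) * of_nat (N n i \<omega>) \<partial>P)
        \<le> c * \<integral>\<^sup>+\<omega>. indicator {z} (gen_size N n \<omega>) * of_nat z \<partial>P" .
  qed
  also have "\<dots> = c * \<integral>\<^sup>+\<omega>. of_nat (gen_size N n \<omega>) \<partial>P"
    by (subst split[of of_nat]) (simp add: nn_integral_suminf)
  also have "\<dots> \<le> c ^ Suc n"
    using mult_left_mono[OF Suc.IH, of c] by simp
  finally show ?case .
qed

section \<open>From bounds on the log-means to a tail bound\<close>

lemma AE_env_iff:
  assumes "{e \<in> space \<nu>. Q e} \<in> sets \<nu>"
  shows "(AE \<omega> in P. Q (\<xi> n \<omega>)) \<longleftrightarrow> (AE e in \<nu>. Q e)"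
  using AE_distr_iff[OF env_measurable assms, of n] unfolding env_law by (rule sym)

text \<open>All environment variables have law \<open>\<nu>\<close>, so an almost sure property of
  \<open>\<xi> 0\<close> passes to \<open>\<nu>\<close> and from there to every
  \<open>\<xi> n\<close>.\<close>

lemma AE_cond_mean_pos_finite:
  assumes "AE \<omega> in P. 0 < cond_mean p \<xi> 0 \<omega> \<and> cond_mean p \<xi> 0 \<omega> < \<infinity>"
  shows "AE \<omega> in P. 0 < cond_mean p \<xi> n \<omega> \<and> cond_mean p \<xi> n \<omega> < \<infinity>"
proof -
  define f where "f e = (\<Sum>k. of_nat k * ennreal (pmf (p e) k))" for e
  have [measurable]: "f \<in> borel_measurable \<nu>"
    unfolding f_def using offspring_measurable by measurable
  have "{e \<in> space \<nu>. 0 < f e \<and> f e < \<infinity>} \<in> sets \<nu>" by measurable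
  from AE_env_iff[OF this] show ?thesis
    using assms unfolding cond_mean_def f_def by blast
qed

lemma AE_cond_mean_le:
  assumes "AE \<omega> in P. 0 < cond_mean p \<xi> 0 \<omega> \<and> cond_mean p \<xi> 0 \<omega> < \<infinity>"
    and "AE \<omega> in P. log_mean p \<xi> (Suc n) \<omega> \<le> B"
  shows "AE \<omega> in P. cond_mean p \<xi> n \<omega> \<le> ennreal (exp B)"
  using AE_cond_mean_pos_finite[OF assms(1), of n] assms(2)
proof eventually_elim
  case (elim \<omega>)
  then obtain r where r: "cond_mean p \<xi> n \<omega> = ennreal r" "0 < r"
    by (cases "cond_mean p \<xi> n \<omega>") auto
  then have "ln r \<le> B" using elim(2) by (simp add: log_mean_def real_mean_def)
  then show ?case using r by (metis exp_le_cancel_iff exp_ln ennreal_leI)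
qed

lemma prob_gen_size_ge:
  assumes "\<And>n. AE \<omega> in P. cond_mean p \<xi> n \<omega> \<le> ennreal c" "0 < c" "0 < t"
  shows "prob {\<omega> \<in> space P. t \<le> real (gen_size N n \<omega>)} \<le> c ^ n / t"
proof -
  have fin: "(\<integral>\<^sup>+\<omega>. ennreal (real (gen_size N n \<omega>)) \<partial>P) \<le> ennreal (c ^ n)"
    using nn_integral_gen_size_le[OF assms(1)] assms(2)
    by (simp add: ennreal_of_nat_eq_real_of_nat ennreal_power)
  then have int: "integrable P (\<lambda>\<omega>. real (gen_size N n \<omega>))"
    by (intro integrableI_bounded) (auto intro: le_less_trans)
  have "expectation (\<lambda>\<omega>. real (gen_size N n \<omega>)) \<le> c ^ n"
    using fin assms(2) by (simp add: nn_integral_eq_integral[OF int] ennreal_le_iff)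
  then have "expectation (\<lambda>\<omega>. real (gen_size N n \<omega>)) / t \<le> c ^ n / t"
    using assms(3) by (simp add: divide_right_mono)
  with integral_Markov_inequality_measure[OF int, of "space P" t] assms(3)
  show ?thesis by auto
qed

end

theorem theorem2p1:
  fixes P :: "'w measure" and \<nu> :: "'e measure"
    and p :: "'e \<Rightarrow> nat pmf"
    and \<xi> :: "nat \<Rightarrow> 'w \<Rightarrow> 'e"
    and N :: "nat \<Rightarrow> nat \<Rightarrow> 'w \<Rightarrow> nat"
    and Z :: "nat \<Rightarrow> 'w \<Rightarrow> nat"
    and X :: "nat \<Rightarrow> 'w \<Rightarrow> real"
    and \<mu> \<sigma>2 M :: real
  assumes bpre: "branching_process_iid_env P \<nu> p \<xi> N"
    and Z_eq: "Z = gen_size N"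
    and X_eq: "X = log_mean p \<xi>"
    and mu_eq: "\<mu> = prob_space.expectation P (X 1)"
    and sigma2_eq: "\<sigma>2 = prob_space.variance P (X 1)"
    and A1_mean: "log_integrable P (cond_mean p \<xi> 0)" "0 < \<mu>"
    and A1_p0: "log_integrable P (\<lambda>\<omega>. ennreal (1 - pmf (p (\<xi> 0 \<omega>)) 0))"
    and A2: "integrable P (\<lambda>\<omega>. (X 1 \<omega>)\<^sup>2)" "0 < \<sigma>2"
    and A3: "integrable P (\<lambda>\<omega>. real (Z 1 \<omega>) * log_plus (real (Z 1 \<omega>)) / real_mean p \<xi> 0 \<omega>)"
    and A4: "AE \<omega> in P. pmf (p (\<xi> 0 \<omega>)) 0 = 0"
    and H1: "M > 0" "\<forall>i\<ge>1. AE \<omega> in P. (X i \<omega> - \<mu>) / M \<le> 1"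
    and H2: "\<exists>r>1. \<exists>q>2.
               integrable P (\<lambda>\<omega>. (real (Z 1 \<omega>) / real_mean p \<xi> 0 \<omega>) powr r) \<and>
               integrable P (\<lambda>\<omega>. \<bar>ln (real_mean p \<xi> 0 \<omega>)\<bar> powr q)"
  shows "\<exists>C \<delta>. C > 0 \<and> 0 < \<delta> \<and> \<delta> < 1 \<and>
           (\<forall>x::real. \<forall>m n::nat. x \<ge> 3 \<longrightarrow> 1 \<le> m \<longrightarrow> m \<le> n \<longrightarrow>
              \<P>(\<omega> in P. (ln (real (Z n \<omega>)) - real n * \<mu>) / (real n * M) \<ge> x)
                \<le> C * \<delta> ^ m / (M * sqrt (real n)))"
proof -
  interpret branching_process_iid_env P \<nu> p \<xi> N by (rule bpre)
  have cond_mean: "AE \<omega> in P. cond_mean p \<xi> n \<omega> \<le> ennreal (exp (\<mu> + M))" for n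
  proof (rule AE_cond_mean_le)
    show "AE \<omega> in P. 0 < cond_mean p \<xi> 0 \<omega> \<and> cond_mean p \<xi> 0 \<omega> < \<infinity>"
      using A1_mean(1) by (simp add: log_integrable_def)
    have "AE \<omega> in P. (X (Suc n) \<omega> - \<mu>) / M \<le> 1" using H1(2) by simp
    then show "AE \<omega> in P. log_mean p \<xi> (Suc n) \<omega> \<le> \<mu> + M"
      by eventually_elim (use H1(1) X_eq in \<open>simp add: field_simps\<close>)
  qed
  \<comment> \<open>The factor 1 is written out so that the bound literally has the form required
    with $C = 1$.\<close>
  have main: "prob {\<omega> \<in> space P. x \<le> (ln (real (Z n \<omega>)) - real n * \<mu>) / (real n * M)}
      \<le> 1 * exp (- M) ^ m / (M * sqrt (real n))"
    if x: "3 \<le> x" and mn: "1 \<le> m" "m \<le> n" for x :: real and m n :: nat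
  proof -
    let ?t = "exp (real n * \<mu> + 3 * real n * M)"
    have n: "1 \<le> real n" using mn by simp
    have nM: "0 < real n * M" using n H1(1) by simp
    have sub: "{\<omega> \<in> space P. x \<le> (ln (real (Z n \<omega>)) - real n * \<mu>) / (real n * M)}
        \<subseteq> {\<omega> \<in> space P. ?t \<le> real (gen_size N n \<omega>)}"
    proof safe
      fix \<omega> assume "x \<le> (ln (real (Z n \<omega>)) - real n * \<mu>) / (real n * M)"
      with x have "3 \<le> (ln (real (Z n \<omega>)) - real n * \<mu>) / (real n * M)" by simp
      then have le: "real n * \<mu> + 3 * real n * M \<le> ln (real (Z n \<omega>))"
        using nM by (simp add: pos_le_divide_eq algebra_simps)
      moreover have "0 < real n * \<mu> + 3 * real n * M"
        using n H1(1) A1_mean(2) by (intro add_pos_pos mult_pos_pos) auto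
      ultimately have "0 < real (Z n \<omega>)" by (cases "Z n \<omega> = 0") auto
      with le show "?t \<le> real (gen_size N n \<omega>)"
        by (simp add: ln_ge_iff Z_eq)
    qed
    have "prob {\<omega> \<in> space P. x \<le> (ln (real (Z n \<omega>)) - real n * \<mu>) / (real n * M)}
        \<le> prob {\<omega> \<in> space P. ?t \<le> real (gen_size N n \<omega>)}"
      by (rule finite_measure_mono[OF sub]) measurable
    also have "\<dots> \<le> exp (\<mu> + M) ^ n / ?t"
      by (rule prob_gen_size_ge[OF cond_mean]) auto
    also have "\<dots> = exp (- (real n * M)) * exp (- (real n * M))"
      by (simp add: exp_of_nat_mult[symmetric] exp_diff[symmetric] exp_add[symmetric] algebra_simps)
    also have "\<dots> \<le> exp (- M) ^ m * (1 / (M * sqrt (real n)))"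
    proof (rule mult_mono)
      show "exp (- (real n * M)) \<le> exp (- M) ^ m"
        using mn H1(1) by (simp add: exp_of_nat_mult[symmetric])
      have "sqrt (real n) \<le> real n"
        using n by (simp add: real_le_lsqrt power2_eq_square)
      then have "M * sqrt (real n) \<le> real n * M" using H1(1) by simp
      also have "\<dots> \<le> exp (real n * M)"
        using exp_ge_add_one_self[of "real n * M"] by linarith
      finally show "exp (- (real n * M)) \<le> 1 / (M * sqrt (real n))"
        using H1(1) n by (simp add: exp_minus field_simps)
    qed auto
    finally show ?thesis by simp
  qed
  have "0 < (1::real) \<and> 0 < exp (- M) \<and> exp (- M) < 1" using H1(1) by simp
  with main show ?thesis by blast
qed

end
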